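(* For every real $z\ge 1$, the functions $F_i(z)$ ($i\in\Delta$) and $f_K(z)$ ($K\in\mathcal C$) satisfy the following system of linear equations: $$\sum_{i\in\Delta}F_i(z)\,P_{ij}=z\,F_j(z)+z\sum_{K\in\mathcal C}f_K(z)\,X_K^{(j)}-\mu_j\qquad\text{for every } j\in\Delta,$$ $$\sum_{i\in\Delta}F_i(z)\,P_{iT_1}=\sum_{K\in\mathcal C}f_K(z)\,\tilde g_{KT}(z)-\mu_{T_1}\qquad\text{for every } T\in\mathcal C,$$ where $T_1$ denotes the first element of $T$.
   Context: Let $(Z_n)_{n\ge1}$ be a time-homogeneous Markov chain with finite state space $\Delta$, initial distribution $\mu_i=P(Z_1=i)$ and one-step transition probabilities $P_{ij}=P(Z_{n+1}=j\mid Z_n=i)$. A pattern is a finite sequence of elements of $\Delta$; for a pattern $K$, $|K|$ is its length and $K=K_1K_2\cdots K_{|K|}$. Let $\mathcal C$ be a finite collection (set) of patterns of length at least $1$. For a pattern $A$, $\tau_A$ is the waiting time until $A$ occurs as a run, i.e. the least $n\ge|A|$ with $(Z_{n-|A|+1},\dots,Z_n)=A$ ($\tau_A=\infty$ if there is none), and $\tau=\min\{\tau_A: A\in\mathcal C\}$. Standing assumptions: (A.1) no pattern in $\mathcal C$ is a subpattern (contiguous block) of another pattern in $\mathcal C$; (A.2) for every $K=K_1\cdots K_m\in\mathcal C$, $P_{K_1K_2}\cdots P_{K_{m-1}K_m}>0$ (an empty product equals $1$); (A.3) $P(\tau<\infty)=1$ and $E(\tau)<\infty$. Notation. For a pattern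 $K$ and $j\in\Delta$, $X_K^{(j)}=1$ if the last element $K_{|K|}$ equals $j$, and $X_K^{(j)}=0$ otherwise. For patterns $K=K_1\cdots K_s$ and $T=T_1\cdots T_t$, $\{KT\}$ is the set of integers $k\in\{1,\dots,\min(s,t)\}$ such that $K_{s-k+1}\cdots K_s=T_1\cdots T_k$. For $i\in\Delta$ and a pattern $K$, $P_{i\to K}=P_{iK_1}P_{K_1K_2}\cdots P_{K_{|K|-1}K_{|K|}}$, and $P_{i\to\phi}=1$ for the empty pattern $\phi$. For $K,T\in\mathcal C$, $$\tilde g_{KT}(z)=\frac{1}{P_{T_1\to T_2\cdots T_{|T|}}}\Big(\sum_{r\in\{KT\},\,1\le r<|T|}z^r\,P_{T_r\to T_{r+1}\cdots T_{|T|}}+\varepsilon_{KT}\,z^{|T|}\Big),$$ where $\varepsilon_{KT}=1$ if $K=T$ and $\varepsilon_{KT}=0$ if $K\ne T$. For $i\in\Delta$, $K\in\mathcal C$, $n\ge1$, let $S_i(n)=P(Z_n=i,\ \tau>n)$ and $S_K(n)=P(\tau=\tau_K=n)$. For $z\ge1$ let $F_i(z)=\sum_{n\ge1}S_i(n)z^{-n}$ and $f_K(z)=\sum_{n\ge1}S_K(n)z^{-n}$. *)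

theory Defs
  imports "HOL-Probability.Probability" "HOL-Library.Sublist"
begin

text \<open>
  The state space is the finite type \<open>'s\<close>, and the chain is indexed from time 1; the value
  \<open>Z 0\<close> is unconstrained and never used. Rows of \<open>P\<close> belonging to states that are never
  visited are not determined by the process; they are only required to be probability vectors.
\<close>

locale markov_chain = prob_space M
  for M :: "'a measure"
    and Z :: "nat \<Rightarrow> 'a \<Rightarrow> 's::finite"
    and \<mu> :: "'s \<Rightarrow> real"
    and P :: "'s \<Rightarrow> 's \<Rightarrow> real" +
  assumes random_variable_Z: "1 \<le> n \<Longrightarrow> Z n \<in> measurable M (count_space UNIV)"
    and initial: "\<mu> i = \<P>(\<omega> in M. Z 1 \<omega> = i)"
    and transition_nonneg: "0 \<le> P i j"
    and transition_sum: "(\<Sum>j\<in>UNIV. P i j) = 1"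
    and markov: "\<lbrakk>1 \<le> n; 0 < \<P>(\<omega> in M. \<forall>m\<in>{1..n}. Z m \<omega> = x m)\<rbrakk> \<Longrightarrow>
      \<P>(\<omega> in M. Z (n + 1) \<omega> = j \<bar> \<forall>m\<in>{1..n}. Z m \<omega> = x m)
        = \<P>(\<omega> in M. Z (n + 1) \<omega> = j \<bar> Z n \<omega> = x n)"
    and homogeneous: "\<lbrakk>1 \<le> n; 0 < \<P>(\<omega> in M. Z n \<omega> = i)\<rbrakk> \<Longrightarrow>
      \<P>(\<omega> in M. Z (n + 1) \<omega> = j \<bar> Z n \<omega> = i) = P i j"

definition waiting_time :: "(nat \<Rightarrow> 'a \<Rightarrow> 's) \<Rightarrow> 's list \<Rightarrow> 'a \<Rightarrow> enat" where
  "waiting_time Z A \<omega> =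
    (INF n\<in>{n. length A \<le> n \<and> map (\<lambda>m. Z m \<omega>) [n - length A + 1..<n + 1] = A}. enat n)"

definition first_time :: "(nat \<Rightarrow> 'a \<Rightarrow> 's) \<Rightarrow> 's list set \<Rightarrow> 'a \<Rightarrow> enat" where
  "first_time Z \<C> \<omega> = (INF A\<in>\<C>. waiting_time Z A \<omega>)"

text \<open>\<open>path_prob P i K\<close> is $P_{i \to K} = P_{i K_1} P_{K_1 K_2} \cdots$\<close>

primrec path_prob :: "('s \<Rightarrow> 's \<Rightarrow> real) \<Rightarrow> 's \<Rightarrow> 's list \<Rightarrow> real" where
  "path_prob P i [] = 1"
| "path_prob P i (k # K) = P i k * path_prob P k K"

definition ends_in :: "'s list \<Rightarrow> 's \<Rightarrow> real" where
  "ends_in K j = (if last K = j then 1 else 0)"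

definition overlaps :: "'s list \<Rightarrow> 's list \<Rightarrow> nat set" where
  "overlaps K T = {k \<in> {1..min (length K) (length T)}. drop (length K - k) K = take k T}"

text \<open>Lists are indexed from 0, so the pattern entry $T_r$ is \<open>T ! (r - 1)\<close>.\<close>

definition g_tilde :: "('s \<Rightarrow> 's \<Rightarrow> real) \<Rightarrow> 's list \<Rightarrow> 's list \<Rightarrow> real \<Rightarrow> real" where
  "g_tilde P K T z =
    1 / path_prob P (hd T) (tl T) *
      ((\<Sum>r\<in>{r \<in> overlaps K T. 1 \<le> r \<and> r < length T}. z ^ r * path_prob P (T ! (r - 1)) (drop r T))
        + (if K = T then 1 else 0) * z ^ length T)"

definition S_state ::
  "'a measure \<Rightarrow> (nat \<Rightarrow> 'a \<Rightarrow> 's) \<Rightarrow> 's list set \<Rightarrow> 's \<Rightarrow> nat \<Rightarrow> real" where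
  "S_state M Z \<C> i n = \<P>(\<omega> in M. Z n \<omega> = i \<and> first_time Z \<C> \<omega> > enat n)"

definition S_pattern ::
  "'a measure \<Rightarrow> (nat \<Rightarrow> 'a \<Rightarrow> 's) \<Rightarrow> 's list set \<Rightarrow> 's list \<Rightarrow> nat \<Rightarrow> real" where
  "S_pattern M Z \<C> K n =
    \<P>(\<omega> in M. first_time Z \<C> \<omega> = waiting_time Z K \<omega> \<and> waiting_time Z K \<omega> = enat n)"

text \<open>
  The series run over $n \ge 1$, whence the shift by \<open>Suc\<close>. That they converge for
  $z \ge 1$ is shown at the end of this theory.
\<close>

definition F_state ::
  "'a measure \<Rightarrow> (nat \<Rightarrow> 'a \<Rightarrow> 's) \<Rightarrow> 's list set \<Rightarrow> 's \<Rightarrow> real \<Rightarrow> real" where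
  "F_state M Z \<C> i z = (\<Sum>n. S_state M Z \<C> i (Suc n) / z ^ Suc n)"

definition f_pattern ::
  "'a measure \<Rightarrow> (nat \<Rightarrow> 'a \<Rightarrow> 's) \<Rightarrow> 's list set \<Rightarrow> 's list \<Rightarrow> real \<Rightarrow> real" where
  "f_pattern M Z \<C> K z = (\<Sum>n. S_pattern M Z \<C> K (Suc n) / z ^ Suc n)"

lemma enat_INF_le_iff:
  "(INF n\<in>{n. Q n}. enat n) \<le> enat k \<longleftrightarrow> (\<exists>n\<le>k. Q n)"
proof
  assume le: "(INF n\<in>{n. Q n}. enat n) \<le> enat k"
  show "\<exists>n\<le>k. Q n"
  proof (rule ccontr)
    assume "\<not> ?thesis"
    then have "enat (Suc k) \<le> (INF n\<in>{n. Q n}. enat n)"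
      by (intro INF_greatest) (auto simp: not_le Suc_le_eq)
    with le have "enat (Suc k) \<le> enat k"
      by (rule order_trans[rotated])
    then show False by simp
  qed
next
  assume "\<exists>n\<le>k. Q n"
  then show "(INF n\<in>{n. Q n}. enat n) \<le> enat k"
    by (meson INF_lower2 enat_ord_simps(1) mem_Collect_eq)
qed

lemma measurable_enatI:
  assumes "\<And>k. {\<omega>\<in>space M. f \<omega> \<le> enat k} \<in> sets M"
  shows "f \<in> measurable M (count_space UNIV)"
proof -
  have le: "Measurable.pred M (\<lambda>\<omega>. f \<omega> \<le> enat k)" for k
    using assms by (simp add: pred_def)
  have fin: "Measurable.pred M (\<lambda>\<omega>. f \<omega> = enat k)" for k
  proof (cases k)
    case 0
    then have "(\<lambda>\<omega>. f \<omega> = enat k) = (\<lambda>\<omega>. f \<omega> \<le> enat k)"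
      by (auto simp: zero_enat_def[symmetric])
    with le show ?thesis by simp
  next
    case (Suc m)
    have "f \<omega> = enat k \<longleftrightarrow> f \<omega> \<le> enat k \<and> \<not> f \<omega> \<le> enat m" for \<omega>
      using Suc by (cases "f \<omega>") auto
    moreover have "Measurable.pred M (\<lambda>\<omega>. f \<omega> \<le> enat k \<and> \<not> f \<omega> \<le> enat m)"
      using le by measurable
    ultimately show ?thesis by simp
  qed
  have inf: "Measurable.pred M (\<lambda>\<omega>. f \<omega> = \<infinity>)"
  proof -
    have "(f \<omega> = \<infinity>) \<longleftrightarrow> (\<forall>k. \<not> f \<omega> \<le> enat k)" for \<omega>
      by (cases "f \<omega>") auto
    moreover have "Measurable.pred M (\<lambda>\<omega>. \<forall>k. \<not> f \<omega> \<le> enat k)"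
      using le by measurable
    ultimately show ?thesis by simp
  qed
  have "f -` {a} \<inter> space M \<in> sets M" for a
    using fin inf by (cases a) (auto simp: pred_def vimage_def Int_def conj_commute)
  then show ?thesis
    by (subst measurable_count_space_eq_countable) auto
qed

context markov_chain
begin

lemma measurable_waiting_time:
  "waiting_time Z A \<in> measurable M (count_space UNIV)"
proof (rule measurable_enatI)
  fix k
  have Zm: "Measurable.pred M (\<lambda>\<omega>. Z m \<omega> = s)" if "1 \<le> m" for m s
    using measurable_compose[OF random_variable_Z[OF that], of "\<lambda>y. y = s" "count_space UNIV"]
    by simp
  have run: "Measurable.pred M (\<lambda>\<omega>. map (\<lambda>m. Z m \<omega>) [n - length A + 1..<n + 1] = A)"
    if "length A \<le> n" for n
  proof -
    have "(map (\<lambda>m. Z m \<omega>) [n - length A + 1..<n + 1] = A) \<longleftrightarrow>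
        (\<forall>l\<in>{..<length A}. Z (n - length A + 1 + l) \<omega> = A ! l)" for \<omega>
      using that by (auto simp: list_eq_iff_nth_eq simp del: upt_Suc)
    moreover have "Measurable.pred M (\<lambda>\<omega>. \<forall>l\<in>{..<length A}. Z (n - length A + 1 + l) \<omega> = A ! l)"
      by (intro pred_intros_finite Zm) auto
    ultimately show ?thesis by (simp del: upt_Suc)
  qed
  have "{\<omega>\<in>space M. waiting_time Z A \<omega> \<le> enat k} =
      (\<Union>n\<in>{length A..k}. {\<omega>\<in>space M. map (\<lambda>m. Z m \<omega>) [n - length A + 1..<n + 1] = A})"
    by (auto simp: waiting_time_def enat_INF_le_iff simp del: upt_Suc)
  also have "\<dots> \<in> sets M"
    using run by (intro sets.finite_UN) (auto simp: pred_def simp del: upt_Suc)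
  finally show "{\<omega>\<in>space M. waiting_time Z A \<omega> \<le> enat k} \<in> sets M" .
qed

lemma measurable_first_time:
  assumes "finite \<C>"
  shows "first_time Z \<C> \<in> measurable M (count_space UNIV)"
proof (rule measurable_enatI)
  fix k
  have iff: "first_time Z \<C> \<omega> \<le> enat k \<longleftrightarrow> (\<exists>A\<in>\<C>. waiting_time Z A \<omega> \<le> enat k)" for \<omega>
  proof
    assume *: "first_time Z \<C> \<omega> \<le> enat k"
    show "\<exists>A\<in>\<C>. waiting_time Z A \<omega> \<le> enat k"
    proof (rule ccontr)
      assume "\<not> ?thesis"
      then have "enat (Suc k) \<le> first_time Z \<C> \<omega>"
        unfolding first_time_def by (intro INF_greatest) (auto simp: not_le Suc_ile_eq)
      with * have "enat (Suc k) \<le> enat k" by (rule order_trans[rotated])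
      then show False by simp
    qed
  qed (auto simp: first_time_def intro: INF_lower2)
  have "{\<omega>\<in>space M. first_time Z \<C> \<omega> \<le> enat k} =
      (\<Union>A\<in>\<C>. {\<omega>\<in>space M. waiting_time Z A \<omega> \<le> enat k})"
    by (auto simp: iff)
  also have "\<dots> \<in> sets M"
  proof (intro sets.finite_UN assms)
    fix A assume "A \<in> \<C>"
    have "waiting_time Z A -` {..enat k} \<inter> space M \<in> sets M"
      by (rule measurable_sets[OF measurable_waiting_time]) simp
    then show "{\<omega>\<in>space M. waiting_time Z A \<omega> \<le> enat k} \<in> sets M"
      by (simp add: vimage_def Int_def conj_commute)
  qed
  finally show "{\<omega>\<in>space M. first_time Z \<C> \<omega> \<le> enat k} \<in> sets M" .
qed

lemma summable_F_state:
  assumes C: "finite \<C>"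
    and fin: "(\<integral>\<^sup>+ \<omega>. ennreal_of_enat (first_time Z \<C> \<omega>) \<partial>M) < \<infinity>"
    and z: "1 \<le> z"
  shows "summable (\<lambda>n. S_state M Z \<C> i (Suc n) / z ^ Suc n)"
proof -
  define p where "p n = \<P>(\<omega> in M. first_time Z \<C> \<omega> > enat n)" for n
  have ev: "{\<omega>\<in>space M. first_time Z \<C> \<omega> > enat n} \<in> sets M" for n
    using measurable_sets[OF measurable_first_time[OF C], of "{enat n<..}"]
    by (simp add: vimage_def Int_def conj_commute)
  have "(\<Sum>n. ennreal (p n)) < \<infinity>"
    using fin by (simp add: nn_integral_enat_function[OF measurable_first_time[OF C]]
        p_def emeasure_eq_measure)
  then have "summable p"
    by (intro summable_suminf_not_top) (auto simp: p_def)
  then have "summable (\<lambda>n. p (Suc n))"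
    by (subst summable_Suc_iff)
  then show ?thesis
  proof (rule summable_comparison_test')
    fix n :: nat assume "n \<ge> 0"
    have "S_state M Z \<C> i (Suc n) \<le> p (Suc n)"
      unfolding S_state_def p_def using ev by (intro finite_measure_mono) auto
    moreover have "S_state M Z \<C> i (Suc n) / z ^ Suc n \<le> S_state M Z \<C> i (Suc n) / 1"
      using z by (intro divide_left_mono one_le_power) (auto simp: S_state_def)
    moreover have "0 \<le> S_state M Z \<C> i (Suc n)"
      by (simp add: S_state_def)
    ultimately show "norm (S_state M Z \<C> i (Suc n) / z ^ Suc n) \<le> p (Suc n)"
      using z by (simp add: abs_mult)
  qed
qed

lemma summable_f_pattern:
  assumes C: "finite \<C>" and z: "1 \<le> z"
  shows "summable (\<lambda>n. S_pattern M Z \<C> K (Suc n) / z ^ Suc n)"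
proof -
  define E where
    "E n = {\<omega>\<in>space M. first_time Z \<C> \<omega> = waiting_time Z K \<omega> \<and> waiting_time Z K \<omega> = enat n}" for n
  have "E n \<in> sets M" for n
  proof -
    have "first_time Z \<C> -` {enat n} \<inter> space M \<inter> (waiting_time Z K -` {enat n} \<inter> space M) \<in> sets M"
      by (intro sets.Int measurable_sets[OF measurable_first_time[OF C]]
          measurable_sets[OF measurable_waiting_time]) auto
    also have "first_time Z \<C> -` {enat n} \<inter> space M \<inter> (waiting_time Z K -` {enat n} \<inter> space M) = E n"
      by (auto simp: E_def)
    finally show ?thesis .
  qed
  moreover have "disjoint_family E"
    by (auto simp: disjoint_family_on_def E_def)
  ultimately have "summable (\<lambda>n. prob (E n))"
    by (intro sums_summable[OF finite_measure_UNION]) auto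
  then have "summable (\<lambda>n. prob (E (Suc n)))"
    by (subst summable_Suc_iff)
  then show ?thesis
  proof (rule summable_comparison_test')
    fix n :: nat assume "n \<ge> 0"
    have "prob (E (Suc n)) / z ^ Suc n \<le> prob (E (Suc n)) / 1"
      using z by (intro divide_left_mono one_le_power) auto
    then show "norm (S_pattern M Z \<C> K (Suc n) / z ^ Suc n) \<le> prob (E (Suc n))"
      using z by (simp add: S_pattern_def E_def)
  qed
qed

end

end

theory Submission
  imports Defs
begin

text \<open>
  Everything observable up to time \<open>n\<close> is a property of the word \<open>Z 1, \<dots>, Z n\<close>, and the law of
  such words is multiplicative: appending \<open>u\<close> to a nonempty word with last letter \<open>i\<close> multiplies its
  probability by \<open>path_prob P i u\<close> (\<open>word_law_append\<close>). Write \<open>\<tau>\<close> for the first time that a pattern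
  is completed. Both families of equations come from computing in two ways the total
  probability of the words of the form \<open>w @ u\<close>, where \<open>w\<close> has length \<open>n\<close> and contains no pattern. Since \<open>w\<close> ranges over the event \<open>\<tau> > n\<close>, it is \<open>\<Sum>i. S_i(n) P_{i \<rightarrow> u}\<close> if \<open>n \<ge> 1\<close>, and the probability that the chain starts
  with \<open>u\<close> if \<open>n = 0\<close>; this last case is the source of the terms in \<open>\<mu>\<close>.

  For a single letter \<open>u = [j]\<close>, either \<open>w @ [j]\<close> still contains no pattern, or exactly one pattern,
  ending in \<open>j\<close>, is completed at time \<open>n + 1\<close>.

  For a pattern \<open>u = T\<close>, the word \<open>w @ T\<close> contains a pattern, so \<open>\<tau> = n + r\<close> for some
  \<open>1 \<le> r \<le> |T|\<close>. Let \<open>K\<close> be the pattern completed then. As \<open>K\<close> is not a proper block of \<open>T\<close>, it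
  reaches back into \<open>w\<close> or equals \<open>T\<close>; in either case \<open>r \<in> {KT}\<close>. Conversely, if \<open>r \<in> {KT}\<close>, then a
  word in which \<open>K\<close> is the first pattern, completed at time \<open>n + r\<close>, already ends in the first \<open>r\<close>
  letters of \<open>T\<close>, and what remains is to append the other letters of \<open>T\<close>, at the cost of a factor
  \<open>P_{T_r \<rightarrow> T_{r+1} \<dots>}\<close>. This is \<open>append_pattern_partition\<close>, and it gives the sum over overlaps in
  \<open>g_tilde\<close>.

  Multiplying by \<open>z^{-n}\<close> and summing over \<open>n \<ge> 0\<close> turns \<open>S_K(n + r)\<close> into
  \<open>z^r f_K(z)\<close>. The terms \<open>S_K(m)\<close> with \<open>m < r\<close> that the sum leaves out vanish, because
  \<open>r \<le> |K|\<close> and \<open>K\<close> cannot be completed before time \<open>|K|\<close>.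
\<close>

section \<open>Words that avoid or first complete a pattern\<close>

definition avoiding :: "'s list set \<Rightarrow> nat \<Rightarrow> 's list set" where
  "avoiding \<C> n = {w. length w = n \<and> (\<forall>A\<in>\<C>. \<not> sublist A w)}"

text \<open>
  Without its last letter the word contains no pattern, so these words describe the event that
  \<open>K\<close> is the first pattern to be completed, at time \<open>n\<close>.
\<close>

definition hitting :: "'s list set \<Rightarrow> 's list \<Rightarrow> nat \<Rightarrow> 's list set" where
  "hitting \<C> K n = {v. length v = n \<and> suffix K v \<and> (\<forall>A\<in>\<C>. \<not> sublist A (butlast v))}"

lemma finite_avoiding [simp]: "finite (avoiding (\<C> :: 's::finite list set) n)"
  by (rule finite_subset[OF _ finite_lists_length_eq[of UNIV n]]) (auto simp: avoiding_def)

lemma finite_hitting [simp]: "finite (hitting (\<C> :: 's::finite list set) K n)"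
  by (rule finite_subset[OF _ finite_lists_length_eq[of UNIV n]]) (auto simp: hitting_def)

lemma sublist_snocD: "sublist A w \<Longrightarrow> w \<noteq> [] \<Longrightarrow> \<not> sublist A (butlast w) \<Longrightarrow> suffix A w"
proof -
  assume a: "sublist A w" "w \<noteq> []" "\<not> sublist A (butlast w)"
  then obtain p s where w: "w = p @ A @ s" by (auto simp: sublist_def)
  have "s = []"
  proof (rule ccontr)
    assume "s \<noteq> []"
    then have "butlast w = p @ A @ butlast s" using w by (simp add: butlast_append)
    with a(3) show False by auto
  qed
  with w show ?thesis by (auto simp: suffix_def)
qed

lemma sublist_imp_suffix_take: "sublist A w \<Longrightarrow> \<exists>m\<le>length w. suffix A (take m w)"
proof -
  assume "sublist A w"
  then obtain p s where w: "w = p @ A @ s" by (auto simp: sublist_def)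
  have "suffix A (take (length p + length A) w)" using w by (simp add: suffix_def)
  moreover have "length p + length A \<le> length w" using w by simp
  ultimately show ?thesis by blast
qed

text \<open>
  An overlap of full length makes \<open>T\<close> a suffix of \<open>K\<close>. Hence in a collection without nested patterns
  it occurs only for \<open>K = T\<close>, which is what the term with \<open>\<epsilon>_{KT}\<close> in \<open>g_tilde\<close> records.
\<close>

lemma length_overlaps_iff:
  assumes "K \<noteq> T \<Longrightarrow> \<not> sublist T K" "1 \<le> length T"
  shows "length T \<in> overlaps K T \<longleftrightarrow> K = T"
proof
  assume "length T \<in> overlaps K T"
  then have "drop (length K - length T) K = T" by (auto simp: overlaps_def)
  then have "suffix T K" by (metis suffix_drop)
  with assms(1) show "K = T" by auto
next
  assume "K = T"
  with assms(2) show "length T \<in> overlaps K T" by (auto simp: overlaps_def Suc_le_eq)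
qed

text \<open>
  The term with \<open>\<epsilon>_{KT}\<close> is the summand for \<open>r = |T|\<close>: there \<open>drop r T\<close> is empty and has path
  probability 1. All overlaps thus contribute to one uniform sum.
\<close>

lemma g_tilde_eq_sum_overlaps:
  assumes "K \<noteq> T \<Longrightarrow> \<not> sublist T K" "1 \<le> length T"
  shows "g_tilde P K T z = 1 / path_prob P (hd T) (tl T) *
      (\<Sum>r\<in>overlaps K T. z ^ r * path_prob P (T ! (r - 1)) (drop r T))"
proof -
  let ?h = "\<lambda>r. z ^ r * path_prob P (T ! (r - 1)) (drop r T)"
  let ?A = "{r \<in> overlaps K T. 1 \<le> r \<and> r < length T}"
  let ?B = "if K = T then {length T} else {}"
  have fin: "finite ?A" "finite ?B"
    by (auto simp: overlaps_def)
  have "r \<in> overlaps K T \<longleftrightarrow> r \<in> ?A \<union> ?B" for r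
  proof (cases "r = length T")
    case True then show ?thesis using length_overlaps_iff[OF assms] by auto
  next
    case False then show ?thesis by (auto simp: overlaps_def)
  qed
  then have split: "overlaps K T = ?A \<union> ?B" by blast
  have "sum ?h (overlaps K T) = sum ?h ?A + sum ?h ?B"
    by (subst split, rule sum.union_disjoint[OF fin]) auto
  then show ?thesis by (simp add: g_tilde_def)
qed

lemma path_prob_append:
  "path_prob P i (u @ v) = path_prob P i u * path_prob P (last (i # u)) v"
  by (induction u arbitrary: i) auto

text \<open>
  Reading \<open>w @ T\<close> up to the first moment at which a pattern \<open>K\<close> is complete cuts it into a word of
  \<open>hitting \<C> K (n + r)\<close> and the rest of \<open>T\<close>. The pattern \<open>K\<close> must be at least \<open>r\<close> letters long, for
  otherwise it would lie inside the first \<open>r\<close> letters of \<open>T\<close>; so the cut is at an overlap.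
\<close>

lemma append_pattern_partition:
  assumes A1: "\<forall>K\<in>\<C>. \<forall>T\<in>\<C>. K \<noteq> T \<longrightarrow> \<not> sublist K T" and T: "T \<in> \<C>"
  shows "(\<lambda>w. w @ T) ` avoiding \<C> n =
    (\<Union>(K, r)\<in>Sigma \<C> (\<lambda>K. overlaps K T). (\<lambda>v. v @ drop r T) ` hitting \<C> K (n + r))"
    (is "?L = ?R")
proof
  show "?L \<subseteq> ?R"
  proof
    fix x assume "x \<in> ?L"
    then obtain w where w: "length w = n" "\<forall>A\<in>\<C>. \<not> sublist A w" "x = w @ T"
      by (auto simp: avoiding_def)
    define bad where "bad r \<longleftrightarrow> (\<exists>A\<in>\<C>. sublist A (w @ take r T))" for r
    have "bad (length T)" unfolding bad_def using T by auto
    define r where "r = (LEAST r. bad r)"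
    have bad_r: "bad r" and r_le: "r \<le> length T" and least: "\<And>k. k < r \<Longrightarrow> \<not> bad k"
      using \<open>bad (length T)\<close> unfolding r_def by (auto intro: LeastI Least_le dest: not_less_Least)
    have "\<not> bad 0" using w by (simp add: bad_def)
    then have r1: "1 \<le> r" using bad_r by (cases r) auto
    define u where "u = w @ take r T"
    have len_u: "length u = n + r" and u_ne: "u \<noteq> []"
      using w r_le r1 by (auto simp: u_def)
    have "butlast u = w @ take (r - 1) T"
      using r1 r_le by (auto simp: u_def butlast_append butlast_take)
    then have av: "\<forall>A\<in>\<C>. \<not> sublist A (butlast u)"
      using least[of "r - 1"] r1 by (simp add: bad_def)
    obtain K where K: "K \<in> \<C>" "sublist K u" using bad_r by (auto simp: bad_def u_def)
    have suf: "suffix K u" using sublist_snocD[OF K(2) u_ne] av K by blast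
    have suf_T: "suffix (take r T) u" by (auto simp: u_def suffix_def)
    have rK: "r \<le> length K"
    proof (rule ccontr)
      assume less: "\<not> r \<le> length K"
      \<comment> \<open>Both are suffixes of \<open>u\<close>, so the shorter one lies inside the other.\<close>
      then have "suffix K (take r T)"
        using suffix_length_suffix[OF suf suf_T] r_le by simp
      then have "sublist K T" by (meson sublist_order.order_trans sublist_take suffix_imp_sublist)
      moreover have "K \<noteq> T" using less r_le by auto
      ultimately show False using A1 K T by blast
    qed
    have suf_K: "suffix (drop (length K - r) K) u"
      using suf suffix_drop suffix_order.trans by blast
    have len_eq: "length (drop (length K - r) K) = length (take r T)"
      using rK r_le by simp
    have "drop (length K - r) K = take r T"
      using suffix_length_suffix[OF suf_K suf_T] suffix_length_suffix[OF suf_T suf_K] len_eq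
      by (intro suffix_order.antisym) simp_all
    then have "r \<in> overlaps K T" using r1 rK r_le by (auto simp: overlaps_def)
    moreover have "u \<in> hitting \<C> K (n + r)" using len_u suf av by (simp add: hitting_def)
    moreover have "x = u @ drop r T" by (simp add: u_def w)
    ultimately show "x \<in> ?R" using K(1) by fast
  qed
  show "?R \<subseteq> ?L"
  proof
    fix x assume "x \<in> ?R"
    then obtain K r v where K: "K \<in> \<C>" and r: "r \<in> overlaps K T"
      and v: "v \<in> hitting \<C> K (n + r)" and x: "x = v @ drop r T" by fast
    obtain p where p: "v = p @ K" using v by (auto simp: hitting_def suffix_def)
    define w where "w = p @ take (length K - r) K"
    have r': "1 \<le> r" "r \<le> length K" "r \<le> length T" "drop (length K - r) K = take r T"
      using r by (auto simp: overlaps_def)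
    have vw: "v = w @ take r T"
      by (simp add: p w_def r'(4)[symmetric])
    have len: "length w = n" using v vw r' by (simp add: hitting_def)
    have "butlast v = w @ butlast (take r T)"
      using r' vw by (auto simp: butlast_append)
    then have "sublist w (butlast v)" by simp
    then have "\<forall>A\<in>\<C>. \<not> sublist A w"
      using v by (auto simp: hitting_def dest: sublist_order.order_trans)
    then have "w \<in> avoiding \<C> n" using len by (simp add: avoiding_def)
    moreover have "x = w @ T" by (simp add: x vw)
    ultimately show "x \<in> ?L" by blast
  qed
qed

text \<open>
  If the word up to the first completion of one pattern were a proper prefix of the word up to the
  first completion of another, the longer one would contain a pattern before its last letter.
  Applied in both directions, this makes the moment of the cut unique.
\<close>

lemma hitting_time_unique:
  assumes "K \<in> \<C>" "v \<in> hitting \<C> K m" "v' \<in> hitting \<C> K' m'" "v @ s = v' @ s'"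
  shows "m' \<le> m"
proof (rule ccontr)
  assume less: "\<not> m' \<le> m"
  have len: "length v = m" "length v' = m'" using assms by (auto simp: hitting_def)
  have "v = take m (v' @ s')" using assms(4) len by (metis append_eq_conv_conj)
  also have "\<dots> = take m (butlast v')" using less len by (simp add: take_butlast)
  finally have "sublist v (butlast v')" by (metis sublist_take)
  moreover have "sublist K v" using assms by (auto simp: hitting_def)
  ultimately have "sublist K (butlast v')" by (metis sublist_order.order_trans)
  then show False using assms by (auto simp: hitting_def)
qed

text \<open>
  Two patterns that end at the same place are nested, the shorter being a suffix of the longer.
\<close>

lemma hitting_pattern_unique:
  assumes A1: "\<forall>K\<in>\<C>. \<forall>T\<in>\<C>. K \<noteq> T \<longrightarrow> \<not> sublist K T"
    and "K \<in> \<C>" "K' \<in> \<C>" "v \<in> hitting \<C> K m" "v \<in> hitting \<C> K' m'"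
  shows "K = K'"
proof -
  have "suffix K v" "suffix K' v" using assms by (auto simp: hitting_def)
  then have "sublist K K' \<or> sublist K' K"
    using suffix_same_cases by blast
  then show ?thesis using A1 assms by metis
qed

lemma append_letter_partition:
  assumes ne: "\<forall>K\<in>\<C>. 1 \<le> length K"
  shows "(\<lambda>w. w @ [j]) ` avoiding \<C> n = {v \<in> avoiding \<C> (Suc n). last v = j}
    \<union> (\<Union>K\<in>{K\<in>\<C>. last K = j}. hitting \<C> K (Suc n))"
    (is "?L = ?R")
proof
  show "?L \<subseteq> ?R"
  proof
    fix x assume "x \<in> ?L"
    then obtain w where w: "length w = n" "\<forall>A\<in>\<C>. \<not> sublist A w" "x = w @ [j]"
      by (auto simp: avoiding_def)
    show "x \<in> ?R"
    proof (cases "\<exists>A\<in>\<C>. sublist A x")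
      case False then show ?thesis using w by (auto simp: avoiding_def)
    next
      case True
      then obtain K where K: "K \<in> \<C>" "sublist K x" by blast
      then have suf: "suffix K x" using w by (intro sublist_snocD) auto
      moreover have "K \<noteq> []" using ne K by auto
      ultimately have "last K = j" using w by (auto simp: suffix_def) (metis last_appendR last_snoc)
      then show ?thesis using w suf K by (auto simp: hitting_def)
    qed
  qed
  show "?R \<subseteq> ?L"
  proof
    fix x assume x: "x \<in> ?R"
    have "length x = Suc n" using x by (auto simp: avoiding_def hitting_def)
    then have x_ne: "x \<noteq> []" by auto
    have "last x = last K" if "suffix K x" "K \<in> \<C>" for K
    proof -
      have "K \<noteq> []" using ne that(2) by auto
      then show ?thesis using that(1) by (auto simp: suffix_def)
    qed
    then have last: "last x = j"
      using x by (auto simp: hitting_def)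
    have "\<not> sublist A (butlast x)" if "A \<in> \<C>" for A
    proof -
      have "sublist A x" if "sublist A (butlast x)"
        using that by (metis sublist_butlast sublist_order.order_trans)
      then show ?thesis using x that by (auto simp: hitting_def avoiding_def)
    qed
    then have "butlast x \<in> avoiding \<C> n" using \<open>length x = Suc n\<close> by (simp add: avoiding_def)
    moreover have "x = butlast x @ [j]" using last x_ne by auto
    ultimately show "x \<in> ?L" by blast
  qed
qed

section \<open>The law of the initial segments of the chain\<close>

definition trajectory :: "(nat \<Rightarrow> 'a \<Rightarrow> 's) \<Rightarrow> nat \<Rightarrow> 'a \<Rightarrow> 's list" where
  "trajectory Z n \<omega> = map (\<lambda>m. Z m \<omega>) [1..<n + 1]"

lemma length_trajectory [simp]: "length (trajectory Z n \<omega>) = n"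
  by (simp add: trajectory_def)

lemma take_trajectory: "m \<le> n \<Longrightarrow> take m (trajectory Z n \<omega>) = trajectory Z m \<omega>"
  by (simp add: trajectory_def take_map del: upt_Suc)

lemma butlast_trajectory: "butlast (trajectory Z n \<omega>) = trajectory Z (n - 1) \<omega>"
  by (simp add: butlast_conv_take take_trajectory)

lemma last_trajectory: "1 \<le> n \<Longrightarrow> last (trajectory Z n \<omega>) = Z n \<omega>"
  by (simp add: trajectory_def)

lemma trajectory_Suc: "trajectory Z (Suc n) \<omega> = trajectory Z n \<omega> @ [Z (Suc n) \<omega>]"
  by (simp add: trajectory_def)

lemma trajectory_eq_iff:
  "trajectory Z (length w) \<omega> = w \<longleftrightarrow> (\<forall>m\<in>{1..length w}. Z m \<omega> = w ! (m - 1))"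
proof (induction w rule: rev_induct)
  case (snoc x w)
  have "{1..length (w @ [x])} = insert (Suc (length w)) {1..length w}"
    by auto
  moreover have "(w @ [x]) ! (m - 1) = w ! (m - 1)" if "m \<in> {1..length w}" for m
    using that by (simp add: nth_append less_diff_conv2 Suc_le_eq)
  ultimately show ?case
    using snoc.IH by (auto simp add: trajectory_Suc)
qed (simp add: trajectory_def)

text \<open>
  A run of \<open>A\<close> completed by time \<open>n\<close> is an occurrence of \<open>A\<close> as a block of the first \<open>n\<close> letters;
  this translates statements about waiting times into statements about words.
\<close>

lemma waiting_time_le_iff:
  "waiting_time Z A \<omega> \<le> enat n \<longleftrightarrow> sublist A (trajectory Z n \<omega>)"
proof -
  have run: "map (\<lambda>m. Z m \<omega>) [m - length A + 1..<m + 1] = A \<longleftrightarrow> suffix A (trajectory Z m \<omega>)"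
    if "length A \<le> m" for m
  proof -
    have "map (\<lambda>m. Z m \<omega>) [m - length A + 1..<m + 1] = drop (m - length A) (trajectory Z m \<omega>)"
      by (simp add: trajectory_def drop_map del: upt_Suc)
    moreover have "drop (m - length A) (trajectory Z m \<omega>) = A \<longleftrightarrow> suffix A (trajectory Z m \<omega>)"
    proof
      assume "suffix A (trajectory Z m \<omega>)"
      then obtain p where p: "trajectory Z m \<omega> = p @ A" by (auto simp: suffix_def)
      have "m - length A = length p"
        using arg_cong[OF p, of length] by simp
      then show "drop (m - length A) (trajectory Z m \<omega>) = A" by (simp only: p) simp
    qed (metis suffix_drop)
    ultimately show ?thesis by simp
  qed
  have "waiting_time Z A \<omega> \<le> enat n \<longleftrightarrow>
      (\<exists>m\<le>n. length A \<le> m \<and> map (\<lambda>m. Z m \<omega>) [m - length A + 1..<m + 1] = A)"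
    unfolding waiting_time_def enat_INF_le_iff ..
  also have "\<dots> \<longleftrightarrow> (\<exists>m\<le>n. suffix A (trajectory Z m \<omega>))"
  proof -
    have "length A \<le> m" if "suffix A (trajectory Z m \<omega>)" for m
      using suffix_length_le[OF that] by simp
    then show ?thesis using run by blast
  qed
  also have "\<dots> \<longleftrightarrow> (\<exists>m\<le>n. suffix A (take m (trajectory Z n \<omega>)))"
    by (auto simp: take_trajectory)
  also have "\<dots> \<longleftrightarrow> sublist A (trajectory Z n \<omega>)"
  proof
    assume "\<exists>m\<le>n. suffix A (take m (trajectory Z n \<omega>))"
    then show "sublist A (trajectory Z n \<omega>)"
      by (blast intro: sublist_order.order_trans[OF suffix_imp_sublist sublist_take])
  qed (use sublist_imp_suffix_take[of A "trajectory Z n \<omega>"] in simp)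
  finally show ?thesis .
qed

lemma first_time_gr_iff:
  "enat n < first_time Z \<C> \<omega> \<longleftrightarrow> trajectory Z n \<omega> \<in> avoiding \<C> n"
proof -
  have "enat n < first_time Z \<C> \<omega> \<longleftrightarrow> enat (Suc n) \<le> first_time Z \<C> \<omega>"
    by (simp add: Suc_ile_eq)
  also have "\<dots> \<longleftrightarrow> (\<forall>A\<in>\<C>. enat n < waiting_time Z A \<omega>)"
    by (simp add: first_time_def le_INF_iff Suc_ile_eq)
  also have "\<dots> \<longleftrightarrow> trajectory Z n \<omega> \<in> avoiding \<C> n"
    by (auto simp: avoiding_def waiting_time_le_iff not_le[symmetric])
  finally show ?thesis .
qed

lemma first_time_eq_waiting_time_iff:
  assumes K: "K \<in> \<C>" and n: "1 \<le> n"
  shows "first_time Z \<C> \<omega> = waiting_time Z K \<omega> \<and> waiting_time Z K \<omega> = enat n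
    \<longleftrightarrow> trajectory Z n \<omega> \<in> hitting \<C> K n"
proof -
  have first_le: "first_time Z \<C> \<omega> \<le> waiting_time Z K \<omega>"
    using K by (auto simp: first_time_def intro: INF_lower)
  have pred_less: "enat n \<le> e \<longleftrightarrow> enat (n - 1) < e" for e
    using n by (cases e) auto
  have "first_time Z \<C> \<omega> = waiting_time Z K \<omega> \<and> waiting_time Z K \<omega> = enat n \<longleftrightarrow>
      enat (n - 1) < first_time Z \<C> \<omega> \<and> waiting_time Z K \<omega> \<le> enat n"
    unfolding pred_less[symmetric] using first_le by (metis order.antisym order.trans order.refl)
  also have "\<dots> \<longleftrightarrow> (\<forall>A\<in>\<C>. \<not> sublist A (butlast (trajectory Z n \<omega>)))
      \<and> sublist K (trajectory Z n \<omega>)"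
    by (simp add: first_time_gr_iff waiting_time_le_iff avoiding_def butlast_trajectory)
  also have "\<dots> \<longleftrightarrow> trajectory Z n \<omega> \<in> hitting \<C> K n"
  proof -
    have "trajectory Z n \<omega> \<noteq> []" using n by (metis length_trajectory list.size(3) not_one_le_zero)
    then show ?thesis
      using K by (auto simp: hitting_def intro: sublist_snocD)
  qed
  finally show ?thesis .
qed

context markov_chain
begin

definition word_law :: "'s list \<Rightarrow> real" where
  "word_law w = \<P>(\<omega> in M. trajectory Z (length w) \<omega> = w)"

text \<open>
  The conditioning events of the Markov property are exactly the events that the trajectory is a
  given word, so their measurability is that of finitely many constraints on single letters.
\<close>

lemma trajectory_event:
  "{\<omega> \<in> space M. trajectory Z (length w) \<omega> = w} \<in> sets M"
proof -
  have Zm: "Measurable.pred M (\<lambda>\<omega>. Z m \<omega> = s)" if "1 \<le> m" for m s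
    using measurable_compose[OF random_variable_Z[OF that], of "\<lambda>y. y = s" "count_space UNIV"]
    by simp
  have "Measurable.pred M (\<lambda>\<omega>. \<forall>m\<in>{1..length w}. Z m \<omega> = w ! (m - 1))"
    by (intro pred_intros_finite Zm) auto
  then show ?thesis by (simp add: trajectory_eq_iff pred_def)
qed

lemma prob_trajectory_in:
  assumes "W \<subseteq> {w. length w = n}"
  shows "\<P>(\<omega> in M. trajectory Z n \<omega> \<in> W) = sum word_law W"
proof -
  have fin: "finite W"
    using finite_subset[OF assms] finite_lists_length_eq[of "UNIV :: 's set" n] by simp
  have len: "length w = n" if "w \<in> W" for w using assms that by auto
  have "{\<omega> \<in> space M. trajectory Z n \<omega> \<in> W} =
      (\<Union>w\<in>W. {\<omega> \<in> space M. trajectory Z (length w) \<omega> = w})"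
    using len by auto
  moreover have ev: "{\<omega> \<in> space M. trajectory Z n \<omega> = w} \<in> sets M" if "w \<in> W" for w
    using trajectory_event[of w] len[OF that] by simp
  moreover have "prob (\<Union>w\<in>W. {\<omega> \<in> space M. trajectory Z (length w) \<omega> = w}) = sum word_law W"
    unfolding word_law_def
    by (rule finite_measure_finite_Union[OF fin])
      (auto simp: disjoint_family_on_def len ev)
  ultimately show ?thesis by simp
qed

lemma word_law_single: "word_law [j] = \<mu> j"
  by (simp add: word_law_def trajectory_def initial)

text \<open>
  The Markov property and homogeneity apply to words of positive probability only. A word of
  probability 0 keeps probability 0 when it is prolonged, so both sides vanish in that case.
\<close>

lemma word_law_snoc:
  assumes v: "v \<noteq> []"
  shows "word_law (v @ [j]) = word_law v * P (last v) j"
proof -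
  define n where "n = length v"
  define x where "x m = v ! (m - 1)" for m
  have n1: "1 \<le> n" using v by (simp add: n_def Suc_le_eq)
  have x_n: "x n = last v" using v by (simp add: x_def n_def last_conv_nth)
  have past: "trajectory Z n \<omega> = v \<longleftrightarrow> (\<forall>m\<in>{1..n}. Z m \<omega> = x m)" for \<omega>
    by (simp add: n_def x_def trajectory_eq_iff)
  have step: "trajectory Z (length (v @ [j])) \<omega> = v @ [j] \<longleftrightarrow>
      Z (n + 1) \<omega> = j \<and> (\<forall>m\<in>{1..n}. Z m \<omega> = x m)" for \<omega>
    by (simp only: past[symmetric]) (auto simp: trajectory_Suc n_def)
  have v_law: "word_law v = \<P>(\<omega> in M. \<forall>m\<in>{1..n}. Z m \<omega> = x m)"
    using past by (simp add: word_law_def n_def[symmetric])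
  have vj_law: "word_law (v @ [j]) = \<P>(\<omega> in M. Z (n + 1) \<omega> = j \<and> (\<forall>m\<in>{1..n}. Z m \<omega> = x m))"
    unfolding word_law_def step ..
  have past_event: "{\<omega> \<in> space M. \<forall>m\<in>{1..n}. Z m \<omega> = x m} \<in> sets M"
    using trajectory_event[of v] past by (simp add: n_def[symmetric])
  show ?thesis
  proof (cases "word_law v = 0")
    case True
    have "word_law (v @ [j]) \<le> word_law v"
      unfolding v_law vj_law by (rule finite_measure_mono[OF _ past_event]) auto
    moreover have "0 \<le> word_law (v @ [j])" by (simp add: word_law_def)
    ultimately show ?thesis using True by simp
  next
    case False
    then have pos: "0 < \<P>(\<omega> in M. \<forall>m\<in>{1..n}. Z m \<omega> = x m)"
      using v_law by (simp add: zero_less_measure_iff)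
    have "{\<omega> \<in> space M. Z n \<omega> = x n} \<in> sets M"
      using measurable_sets[OF random_variable_Z[OF n1], of "{x n}"]
      by (simp add: vimage_def Int_def conj_commute)
    then have "\<P>(\<omega> in M. \<forall>m\<in>{1..n}. Z m \<omega> = x m) \<le> \<P>(\<omega> in M. Z n \<omega> = x n)"
      by (rule finite_measure_mono[rotated]) (use n1 in auto)
    with pos have pos_n: "0 < \<P>(\<omega> in M. Z n \<omega> = x n)" by linarith
    have "\<P>(\<omega> in M. Z (n + 1) \<omega> = j \<bar> \<forall>m\<in>{1..n}. Z m \<omega> = x m) = P (x n) j"
      using markov[OF n1 pos] homogeneous[OF n1 pos_n] by simp
    then show ?thesis
      using pos by (simp add: cond_prob_def v_law vj_law x_n field_simps)
  qed
qed

lemma word_law_append: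
  "v \<noteq> [] \<Longrightarrow> word_law (v @ u) = word_law v * path_prob P (last v) u"
proof (induction u rule: rev_induct)
  case (snoc j u)
  have "word_law (v @ u @ [j]) = word_law (v @ u) * P (last (v @ u)) j"
    using word_law_snoc[of "v @ u" j] snoc.prems by simp
  then show ?case
    using snoc by (auto simp: path_prob_append last_append)
qed simp

lemma S_state_eq_sum:
  assumes "1 \<le> n"
  shows "S_state M Z \<C> i n = (\<Sum>w | w \<in> avoiding \<C> n \<and> last w = i. word_law w)"
proof -
  have "S_state M Z \<C> i n = \<P>(\<omega> in M. trajectory Z n \<omega> \<in> {w \<in> avoiding \<C> n. last w = i})"
    unfolding S_state_def
    by (intro arg_cong[of _ _ prob] Collect_cong) (use assms in
      \<open>auto simp: first_time_gr_iff last_trajectory\<close>)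
  also have "\<dots> = (\<Sum>w | w \<in> avoiding \<C> n \<and> last w = i. word_law w)"
    by (rule prob_trajectory_in) (auto simp: avoiding_def)
  finally show ?thesis .
qed

lemma S_pattern_eq_sum:
  assumes "K \<in> \<C>" "1 \<le> n"
  shows "S_pattern M Z \<C> K n = sum word_law (hitting \<C> K n)"
  unfolding S_pattern_def first_time_eq_waiting_time_iff[OF assms]
  by (rule prob_trajectory_in) (auto simp: hitting_def)

lemma S_pattern_eq_0:
  assumes "K \<in> \<C>" "1 \<le> n" "n < length K"
  shows "S_pattern M Z \<C> K n = 0"
proof -
  have "hitting \<C> K n = {}" using assms(3) by (auto simp: hitting_def dest: suffix_length_le)
  then show ?thesis by (simp add: S_pattern_eq_sum[OF assms(1,2)])
qed

section \<open>Recurrences at a fixed time\<close>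

text \<open>
  The probability that no pattern is completed by time \<open>n\<close> and that the letter at time \<open>n + 1\<close> is
  \<open>j\<close>. At time 0 there is no state to start a transition from, and the initial law takes its place.
\<close>

definition entry_prob :: "'s list set \<Rightarrow> nat \<Rightarrow> 's \<Rightarrow> real" where
  "entry_prob \<C> n j = (if n = 0 then \<mu> j else \<Sum>i\<in>UNIV. S_state M Z \<C> i n * P i j)"

text \<open>
  The pattern-free words of length \<open>n\<close> are grouped by their last letter, which alone determines the
  factor gained by appending \<open>u\<close>. For \<open>n = 0\<close> the empty word is the only one, as no pattern is empty.
\<close>

lemma sum_word_law_append:
  assumes ne: "\<forall>K\<in>\<C>. 1 \<le> length K" and u: "u \<noteq> []"
  shows "sum word_law ((\<lambda>w. w @ u) ` avoiding \<C> n)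
    = entry_prob \<C> n (hd u) * path_prob P (hd u) (tl u)"
proof -
  have reindex: "sum word_law ((\<lambda>w. w @ u) ` avoiding \<C> n) = (\<Sum>w\<in>avoiding \<C> n. word_law (w @ u))"
    by (subst sum.reindex) (auto simp: inj_on_def)
  show ?thesis
  proof (cases "n = 0")
    case True
    have "avoiding \<C> n = {[]}" using True ne by (auto simp: avoiding_def)
    moreover have "word_law u = \<mu> (hd u) * path_prob P (hd u) (tl u)"
      using u word_law_append[of "[hd u]" "tl u"] by (simp add: word_law_single)
    ultimately show ?thesis using reindex True by (simp add: entry_prob_def)
  next
    case False
    have "word_law (w @ u) = word_law w * P (last w) (hd u) * path_prob P (hd u) (tl u)"
      if "w \<in> avoiding \<C> n" for w
    proof -
      have "w \<noteq> []" using that False by (auto simp: avoiding_def)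
      then have "word_law (w @ u) = word_law w * path_prob P (last w) (hd u # tl u)"
        using u word_law_append[of w u] by simp
      then show ?thesis by simp
    qed
    then have "(\<Sum>w\<in>avoiding \<C> n. word_law (w @ u)) =
        (\<Sum>w\<in>avoiding \<C> n. word_law w * P (last w) (hd u)) * path_prob P (hd u) (tl u)"
      by (simp add: sum_distrib_right)
    also have "(\<Sum>w\<in>avoiding \<C> n. word_law w * P (last w) (hd u)) =
        (\<Sum>i\<in>UNIV. \<Sum>w | w \<in> avoiding \<C> n \<and> last w = i. word_law w * P (last w) (hd u))"
      by (rule sum.group[symmetric]) auto
    also have "\<dots> = entry_prob \<C> n (hd u)"
      using False by (auto simp: entry_prob_def S_state_eq_sum sum_distrib_right intro!: sum.cong)
    finally show ?thesis using reindex by simp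
  qed
qed

lemma entry_prob_state:
  assumes A1: "\<forall>K\<in>\<C>. \<forall>T\<in>\<C>. K \<noteq> T \<longrightarrow> \<not> sublist K T"
    and ne: "\<forall>K\<in>\<C>. 1 \<le> length K" and fin: "finite \<C>"
  shows "entry_prob \<C> n j = S_state M Z \<C> j (n + 1)
    + (\<Sum>K\<in>\<C>. S_pattern M Z \<C> K (n + 1) * ends_in K j)"
proof -
  let ?H = "\<Union>K\<in>{K\<in>\<C>. last K = j}. hitting \<C> K (Suc n)"
  have "entry_prob \<C> n j = sum word_law ((\<lambda>w. w @ [j]) ` avoiding \<C> n)"
    using sum_word_law_append[OF ne, of "[j]" n] by simp
  also have "\<dots> = sum word_law {v \<in> avoiding \<C> (Suc n). last v = j} + sum word_law ?H"
    unfolding append_letter_partition[OF ne]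
    by (rule sum.union_disjoint) (use fin in \<open>simp_all, auto simp: avoiding_def hitting_def\<close>)
  also have "sum word_law ?H = (\<Sum>K | K \<in> \<C> \<and> last K = j. sum word_law (hitting \<C> K (Suc n)))"
    by (rule sum.UNION_disjoint) (use fin hitting_pattern_unique[OF A1] in auto)
  also have "\<dots> = (\<Sum>K\<in>\<C>. S_pattern M Z \<C> K (Suc n) * ends_in K j)"
    by (rule sum.mono_neutral_cong_left) (use fin in \<open>auto simp: ends_in_def S_pattern_eq_sum\<close>)
  finally show ?thesis by (simp add: S_state_eq_sum)
qed

text \<open>
  The left-hand side is the probability that no pattern is completed by time \<open>n\<close> and that \<open>T\<close>
  follows immediately. The right-hand side splits this event according to the pattern \<open>K\<close> that is
  completed first and the number \<open>r\<close> of letters of \<open>T\<close> read by then; the last letter of \<open>K\<close> is then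
  the \<open>r\<close>-th letter of \<open>T\<close>, from which the remaining transitions start.
\<close>

lemma entry_prob_pattern:
  assumes A1: "\<forall>K\<in>\<C>. \<forall>T\<in>\<C>. K \<noteq> T \<longrightarrow> \<not> sublist K T"
    and ne: "\<forall>K\<in>\<C>. 1 \<le> length K" and fin: "finite \<C>" and T: "T \<in> \<C>"
  shows "entry_prob \<C> n (hd T) * path_prob P (hd T) (tl T) =
    (\<Sum>K\<in>\<C>. \<Sum>r\<in>overlaps K T. S_pattern M Z \<C> K (n + r) * path_prob P (T ! (r - 1)) (drop r T))"
proof -
  let ?I = "Sigma \<C> (\<lambda>K. overlaps K T)"
  let ?W = "\<lambda>K r. (\<lambda>v. v @ drop r T) ` hitting \<C> K (n + r)"
  have T_ne: "T \<noteq> []" using ne T by auto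
  have fin_o: "finite (overlaps K T)" for K by (simp add: overlaps_def)
  have "entry_prob \<C> n (hd T) * path_prob P (hd T) (tl T) =
      sum word_law ((\<lambda>w. w @ T) ` avoiding \<C> n)"
    using sum_word_law_append[OF ne T_ne] by simp
  also have "\<dots> = sum word_law (\<Union>p\<in>?I. case p of (K, r) \<Rightarrow> ?W K r)"
    unfolding append_pattern_partition[OF A1 T] ..
  also have "\<dots> = (\<Sum>p\<in>?I. sum word_law (case p of (K, r) \<Rightarrow> ?W K r))"
  proof (rule sum.UNION_disjoint)
    show "finite ?I" using fin fin_o by auto
    show "\<forall>p\<in>?I. finite (case p of (K, r) \<Rightarrow> ?W K r)" by auto
    have "p = q" if p: "p \<in> ?I" and q: "q \<in> ?I"
      and x: "x \<in> (case p of (K, r) \<Rightarrow> ?W K r)" "x \<in> (case q of (K, r) \<Rightarrow> ?W K r)" for p q x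
    proof -
      obtain K r K' r' where pq: "p = (K, r)" "q = (K', r')" by (cases p, cases q)
      obtain v v' where v: "v \<in> hitting \<C> K (n + r)" "v' \<in> hitting \<C> K' (n + r')"
        and eq: "v @ drop r T = v' @ drop r' T" using x pq by auto
      have K: "K \<in> \<C>" "K' \<in> \<C>" using p q pq by auto
      have r: "r = r'"
        using hitting_time_unique[OF K(1) v eq] hitting_time_unique[OF K(2) v(2,1) eq[symmetric]]
        by simp
      then have "v = v'" using eq by simp
      then show ?thesis using hitting_pattern_unique[OF A1 K] v r pq by blast
    qed
    then show "\<forall>p\<in>?I. \<forall>q\<in>?I. p \<noteq> q \<longrightarrow>
        (case p of (K, r) \<Rightarrow> ?W K r) \<inter> (case q of (K, r) \<Rightarrow> ?W K r) = {}"
      by blast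
  qed
  also have "\<dots> = (\<Sum>(K, r)\<in>?I. S_pattern M Z \<C> K (n + r) * path_prob P (T ! (r - 1)) (drop r T))"
  proof (rule sum.cong[OF refl])
    fix p assume "p \<in> ?I"
    then obtain K r where p: "p = (K, r)" "K \<in> \<C>" and r: "r \<in> overlaps K T" by auto
    have r': "1 \<le> r" "r \<le> length K" "r \<le> length T" "drop (length K - r) K = take r T"
      using r by (auto simp: overlaps_def)
    have "word_law (v @ drop r T) = word_law v * path_prob P (T ! (r - 1)) (drop r T)"
      if v: "v \<in> hitting \<C> K (n + r)" for v
    proof -
      have K_ne: "K \<noteq> []" using ne p by auto
      have v_ne: "v \<noteq> []" using v r' by (auto simp: hitting_def)
      have "last v = last K" using v K_ne by (auto simp: hitting_def suffix_def)
      also have "\<dots> = last (drop (length K - r) K)"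
        using r'(1,2) K_ne by (intro last_drop[symmetric]) simp
      also have "\<dots> = T ! (r - 1)" using r' T_ne by (simp add: last_conv_nth)
      finally show ?thesis using word_law_append[OF v_ne] by simp
    qed
    then have "sum word_law (?W K r) =
        sum word_law (hitting \<C> K (n + r)) * path_prob P (T ! (r - 1)) (drop r T)"
      by (subst sum.reindex) (auto simp: inj_on_def sum_distrib_right)
    then show "sum word_law (case p of (K, r) \<Rightarrow> ?W K r) = (case p of (K, r) \<Rightarrow>
        S_pattern M Z \<C> K (n + r) * path_prob P (T ! (r - 1)) (drop r T))"
      using p r' by (simp add: S_pattern_eq_sum)
  qed
  also have "\<dots> = (\<Sum>K\<in>\<C>. \<Sum>r\<in>overlaps K T.
      S_pattern M Z \<C> K (n + r) * path_prob P (T ! (r - 1)) (drop r T))"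
    using fin fin_o by (simp add: sum.Sigma)
  finally show ?thesis .
qed

section \<open>Generating functions\<close>

lemma entry_prob_sums:
  assumes "finite \<C>" "(\<integral>\<^sup>+ \<omega>. ennreal_of_enat (first_time Z \<C> \<omega>) \<partial>M) < \<infinity>" "1 \<le> z"
  shows "(\<lambda>n. entry_prob \<C> n j / z ^ n) sums (\<mu> j + (\<Sum>i\<in>UNIV. F_state M Z \<C> i z * P i j))"
proof -
  have "(\<lambda>n. \<Sum>i\<in>UNIV. S_state M Z \<C> i (Suc n) / z ^ Suc n * P i j)
      sums (\<Sum>i\<in>UNIV. F_state M Z \<C> i z * P i j)"
    unfolding F_state_def
    by (intro sums_sum sums_mult2 summable_sums summable_F_state assms)
  moreover have "(\<Sum>i\<in>UNIV. S_state M Z \<C> i (Suc n) / z ^ Suc n * P i j)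
      = entry_prob \<C> (Suc n) j / z ^ Suc n" for n
    by (simp add: entry_prob_def sum_divide_distrib del: power_Suc)
  ultimately have "(\<lambda>n. entry_prob \<C> (Suc n) j / z ^ Suc n)
      sums (\<Sum>i\<in>UNIV. F_state M Z \<C> i z * P i j)"
    by (simp del: power_Suc)
  from sums_Suc[OF this] show ?thesis
    by (simp add: entry_prob_def add.commute)
qed

text \<open>
  The shift by \<open>r\<close> drops the terms at times below \<open>r\<close>, all of which vanish because \<open>r \<le> |K|\<close>.
\<close>

lemma S_pattern_shift_sums:
  assumes "finite \<C>" "K \<in> \<C>" "1 \<le> z" and r: "1 \<le> r" "r \<le> length K"
  shows "(\<lambda>n. S_pattern M Z \<C> K (n + r) / z ^ n) sums (z ^ r * f_pattern M Z \<C> K z)"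
proof -
  let ?a = "\<lambda>n. S_pattern M Z \<C> K (Suc n) / z ^ Suc n"
  have "?a sums f_pattern M Z \<C> K z"
    unfolding f_pattern_def using assms by (intro summable_sums summable_f_pattern)
  moreover have "(\<Sum>n<r - 1. ?a n) = 0"
    using assms by (intro sum.neutral) (auto simp: S_pattern_eq_0)
  ultimately have "(\<lambda>n. ?a (n + (r - 1))) sums f_pattern M Z \<C> K z"
    using sums_iff_shift[of ?a "r - 1" "f_pattern M Z \<C> K z"] by simp
  then have "(\<lambda>n. z ^ r * ?a (n + (r - 1))) sums (z ^ r * f_pattern M Z \<C> K z)"
    by (rule sums_mult)
  moreover have "z ^ r * ?a (n + (r - 1)) = S_pattern M Z \<C> K (n + r) / z ^ n" for n
  proof -
    have "Suc (n + (r - 1)) = n + r" using r by simp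
    then show ?thesis using \<open>1 \<le> z\<close> by (simp add: power_add del: power_Suc)
  qed
  ultimately show ?thesis by simp
qed

lemma S_state_shift_sums:
  assumes "finite \<C>" "(\<integral>\<^sup>+ \<omega>. ennreal_of_enat (first_time Z \<C> \<omega>) \<partial>M) < \<infinity>" "1 \<le> z"
  shows "(\<lambda>n. S_state M Z \<C> i (n + 1) / z ^ n) sums (z * F_state M Z \<C> i z)"
proof -
  have "(\<lambda>n. z * (S_state M Z \<C> i (Suc n) / z ^ Suc n)) sums (z * F_state M Z \<C> i z)"
    unfolding F_state_def by (intro sums_mult summable_sums summable_F_state assms)
  then show ?thesis using \<open>1 \<le> z\<close> by simp
qed

lemma state_equation:
  assumes A1: "\<forall>K\<in>\<C>. \<forall>T\<in>\<C>. K \<noteq> T \<longrightarrow> \<not> sublist K T"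
    and ne: "\<forall>K\<in>\<C>. 1 \<le> length K" and fin: "finite \<C>"
    and E: "(\<integral>\<^sup>+ \<omega>. ennreal_of_enat (first_time Z \<C> \<omega>) \<partial>M) < \<infinity>" and z: "1 \<le> z"
  shows "(\<Sum>i\<in>UNIV. F_state M Z \<C> i z * P i j)
    = z * F_state M Z \<C> j z + z * (\<Sum>K\<in>\<C>. f_pattern M Z \<C> K z * ends_in K j) - \<mu> j"
proof -
  have "(\<lambda>n. S_pattern M Z \<C> K (n + 1) / z ^ n) sums (z * f_pattern M Z \<C> K z)" if "K \<in> \<C>" for K
    using S_pattern_shift_sums[OF fin that z, of 1] ne that by simp
  then have "(\<lambda>n. S_state M Z \<C> j (n + 1) / z ^ n
        + (\<Sum>K\<in>\<C>. S_pattern M Z \<C> K (n + 1) / z ^ n * ends_in K j))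
      sums (z * F_state M Z \<C> j z + (\<Sum>K\<in>\<C>. z * f_pattern M Z \<C> K z * ends_in K j))"
    by (intro sums_add S_state_shift_sums[OF fin E z] sums_sum sums_mult2)
  then have "(\<lambda>n. entry_prob \<C> n j / z ^ n)
      sums (z * F_state M Z \<C> j z + (\<Sum>K\<in>\<C>. z * f_pattern M Z \<C> K z * ends_in K j))"
    by (simp add: entry_prob_state[OF A1 ne fin] add_divide_distrib sum_divide_distrib)
  from sums_unique2[OF this entry_prob_sums[OF fin E z]] show ?thesis
    by (simp add: sum_distrib_left mult.assoc)
qed

text \<open>
  The recurrences for \<open>T\<close> carry the common factor \<open>path_prob P (hd T) (tl T)\<close>; cancelling it
  is what produces the denominator of \<open>g_tilde\<close> and requires the transitions inside \<open>T\<close> to have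
  positive probability.
\<close>

lemma pattern_equation:
  assumes A1: "\<forall>K\<in>\<C>. \<forall>T\<in>\<C>. K \<noteq> T \<longrightarrow> \<not> sublist K T"
    and ne: "\<forall>K\<in>\<C>. 1 \<le> length K" and fin: "finite \<C>"
    and E: "(\<integral>\<^sup>+ \<omega>. ennreal_of_enat (first_time Z \<C> \<omega>) \<partial>M) < \<infinity>" and z: "1 \<le> z"
    and T: "T \<in> \<C>" and pos: "path_prob P (hd T) (tl T) > 0"
  shows "(\<Sum>i\<in>UNIV. F_state M Z \<C> i z * P i (hd T))
    = (\<Sum>K\<in>\<C>. f_pattern M Z \<C> K z * g_tilde P K T z) - \<mu> (hd T)"
proof -
  let ?c = "path_prob P (hd T) (tl T)"
  let ?q = "\<lambda>r. path_prob P (T ! (r - 1)) (drop r T)"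
  have "(\<lambda>n. \<Sum>K\<in>\<C>. \<Sum>r\<in>overlaps K T. S_pattern M Z \<C> K (n + r) / z ^ n * ?q r)
      sums (\<Sum>K\<in>\<C>. \<Sum>r\<in>overlaps K T. z ^ r * f_pattern M Z \<C> K z * ?q r)"
    by (intro sums_sum sums_mult2 S_pattern_shift_sums[OF fin _ z]) (auto simp: overlaps_def)
  moreover have "(\<Sum>K\<in>\<C>. \<Sum>r\<in>overlaps K T. S_pattern M Z \<C> K (n + r) / z ^ n * ?q r)
      = entry_prob \<C> n (hd T) / z ^ n * ?c" for n
    using entry_prob_pattern[OF A1 ne fin T, of n] by (simp add: sum_divide_distrib)
  ultimately have "(\<lambda>n. entry_prob \<C> n (hd T) / z ^ n * ?c)
      sums (\<Sum>K\<in>\<C>. \<Sum>r\<in>overlaps K T. z ^ r * f_pattern M Z \<C> K z * ?q r)"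
    by simp
  from sums_unique2[OF this sums_mult2[OF entry_prob_sums[OF fin E z]]]
  have "(\<mu> (hd T) + (\<Sum>i\<in>UNIV. F_state M Z \<C> i z * P i (hd T))) * ?c =
      (\<Sum>K\<in>\<C>. \<Sum>r\<in>overlaps K T. z ^ r * f_pattern M Z \<C> K z * ?q r)" by simp
  also have "\<dots> = (\<Sum>K\<in>\<C>. f_pattern M Z \<C> K z * g_tilde P K T z) * ?c"
    unfolding sum_distrib_right
  proof (rule sum.cong[OF refl])
    fix K assume "K \<in> \<C>"
    then have "g_tilde P K T z = 1 / ?c * (\<Sum>r\<in>overlaps K T. z ^ r * ?q r)"
      using A1 T ne by (intro g_tilde_eq_sum_overlaps) auto
    then show "(\<Sum>r\<in>overlaps K T. z ^ r * f_pattern M Z \<C> K z * ?q r)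
        = f_pattern M Z \<C> K z * g_tilde P K T z * ?c"
      using pos by (simp add: sum_distrib_left mult_ac)
  qed
  finally show ?thesis using pos by simp
qed

end

theorem theorem2p1:
  fixes M :: "'a measure"
    and Z :: "nat \<Rightarrow> 'a \<Rightarrow> 's::finite"
    and \<mu> :: "'s \<Rightarrow> real"
    and P :: "'s \<Rightarrow> 's \<Rightarrow> real"
    and \<C> :: "'s list set"
    and z :: real
  assumes "markov_chain M Z \<mu> P"
    and "finite \<C>"
    and "\<forall>K\<in>\<C>. 1 \<le> length K"
    and A1: "\<forall>K\<in>\<C>. \<forall>T\<in>\<C>. K \<noteq> T \<longrightarrow> \<not> sublist K T"
    and A2: "\<forall>K\<in>\<C>. path_prob P (hd K) (tl K) > 0"
    and A3_finite: "\<P>(\<omega> in M. first_time Z \<C> \<omega> < \<infinity>) = 1"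
    and A3_expectation: "(\<integral>\<^sup>+ \<omega>. ennreal_of_enat (first_time Z \<C> \<omega>) \<partial>M) < \<infinity>"
    and "1 \<le> z"
  shows "(\<forall>j. (\<Sum>i\<in>UNIV. F_state M Z \<C> i z * P i j)
            = z * F_state M Z \<C> j z + z * (\<Sum>K\<in>\<C>. f_pattern M Z \<C> K z * ends_in K j) - \<mu> j)
       \<and> (\<forall>T\<in>\<C>. (\<Sum>i\<in>UNIV. F_state M Z \<C> i z * P i (hd T))
            = (\<Sum>K\<in>\<C>. f_pattern M Z \<C> K z * g_tilde P K T z) - \<mu> (hd T))"
proof -
  interpret markov_chain M Z \<mu> P by fact
  show ?thesis
    using state_equation[OF A1 assms(3,2) A3_expectation assms(8)]
      pattern_equation[OF A1 assms(3,2) A3_expectation assms(8)] A2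
    by blast
qed

end
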